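(* Let $H$ be a finite hypergraph with positive functions $\delta_{V(H)}:V(H)\to(0,\infty)$ and $\delta_{E(H)}:E(H)\to(0,\infty)$. Suppose that for every unit $W_E\in\mathfrak{U}(H)$ there is a constant $c_E$ with $\delta_{V(H)}(v)=c_E$ for all $v\in W_E$. Then the complete spectrum of $A_{(H,\delta_{V(H)},\delta_{E(H)})}$ is the following (eigenvalues counted with multiplicity). (1) For each unit $W_E\in\mathfrak{U}(H)$, $-\sum_{e\in E}\frac{\delta_{E(H)}(e)}{c_E|e|^2}$ is an eigenvalue of $A_{(H,\delta_{V(H)},\delta_{E(H)})}$ with multiplicity $|W_E|-1$ (this being the contribution of the unit $W_E$ to the list), and $S_{W_E}$ is a subspace of the eigenspace of the eigenvalue $-\sum_{e\in E}\frac{\delta_{E(H)}(e)}{c_E|e|^2}$. (2) For each eigenvalue $\lambda$ of $\hat{A}_H$ with eigenvector $y:\mathfrak{U}(H)\to\mathbb{C}$, $\lambda$ is also an eigenvalue of $A_{(H,\delta_{V(H)},\delta_{E(H)})}$ with the blow up $y_{\mathfrak{R}_s}$ as an eigenvector.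
   Context: A (finite) hypergraph $H$ is a pair $(V(H),E(H))$, where $V(H)$ is a non-empty finite set and $E(H)$ is a collection of non-empty subsets of $V(H)$. For $v\in V(H)$ the star is $E_v(H)=\{e\in E(H):v\in e\}$. $\mathbb{C}^{X}$ is the space of functions $X\to\mathbb{C}$. Units: $\mathfrak{R}_s=\{(u,v)\in V(H)\times V(H):E_u(H)=E_v(H)\}$ is an equivalence relation; its classes are called units and $\mathfrak{U}(H)$ is the set of all units. A unit is written $W_E$, where $E\subseteq E(H)$ is its generating set: $W_E=\{v\in V(H):E_v(H)=E\}$. The general adjacency operator $A_{(H,\delta_{V(H)},\delta_{E(H)})}:\mathbb{C}^{V(H)}\to\mathbb{C}^{V(H)}$ is $$(A_{(H,\delta_{V(H)},\delta_{E(H)})}x)(v)=\sum_{e\in E_v(H)}\frac{\delta_{E(H)}(e)}{\delta_{V(H)}(v)}\frac{1}{|e|^2}\sum_{u\in e;\,u\neq v}x(u).$$ When $\delta_{V(H)}$ equals a constant $c_E$ on each unit $W_E$, and $\mathfrak{U}(H)=\{W_{E_1},\dots,W_{E_m}\}$, $\hat{A}_H:\mathbb{C}^{\mathfrak{U}(H)}\to\mathbb{C}^{\mathfrak{U}(H)}$ is the contraction $(\hat{A}_Hy)(W_{E_j})=\sum_{i=1}^m c^i_j\,y(W_{E_i})$ with $$c^i_j=\sum_{e\in E_j}\frac{\delta_{E(H)}(e)}{c_{E_j}}\frac{1}{|e|^2}|W_{E_i}\cap e|\ \ (i\neq j),\qquad c^i_i=\sum_{e\in E_i}\frac{\delta_{E(H)}(e)}{c_{E_i}}\frac{1}{|e|^2}\big(|W_{E_i}\cap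 e|-1\big).$$ For $y:\mathfrak{U}(H)\to\mathbb{C}$, the blow up $y_{\mathfrak{R}_s}:V(H)\to\mathbb{C}$ is $y_{\mathfrak{R}_s}(v)=y(W)$ where $W$ is the unit containing $v$. For $U\subseteq V(H)$, $S_U=\{x\in\mathbb{C}^{V(H)}: \{v: x(v)\neq 0\}\subseteq U,\ \sum_{v\in U}x(v)=0\}$. *)

theory Defs
  imports
    "Jordan_Normal_Form.Char_Poly"
    "HOL-Library.Function_Algebras"
    "HOL-Library.Multiset"
begin

section \<open>Linear operators on the space of complex functions on a finite set\<close>

definition fscale :: "complex \<Rightarrow> ('i \<Rightarrow> complex) \<Rightarrow> 'i \<Rightarrow> complex" where
  "fscale a x = (\<lambda>i. a * x i)"

global_interpretation cfun: vector_space "fscale :: complex \<Rightarrow> ('i \<Rightarrow> complex) \<Rightarrow> 'i \<Rightarrow> complex"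
  by unfold_locales (auto simp: fscale_def fun_eq_iff algebra_simps)

text \<open>A function on \<open>X\<close> is represented by its extension by zero to the whole type.\<close>

definition fun_space :: "'i set \<Rightarrow> ('i \<Rightarrow> complex) set" where
  "fun_space X = {x. \<forall>i. i \<notin> X \<longrightarrow> x i = 0}"

definition eigenspace ::
    "'i set \<Rightarrow> (('i \<Rightarrow> complex) \<Rightarrow> 'i \<Rightarrow> complex) \<Rightarrow> complex \<Rightarrow> ('i \<Rightarrow> complex) set" where
  "eigenspace X L \<theta> = {x \<in> fun_space X. L x = fscale \<theta> x}"

definition is_eigenvector ::
    "'i set \<Rightarrow> (('i \<Rightarrow> complex) \<Rightarrow> 'i \<Rightarrow> complex) \<Rightarrow> complex \<Rightarrow> ('i \<Rightarrow> complex) \<Rightarrow> bool" where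
  "is_eigenvector X L \<theta> x \<longleftrightarrow> x \<in> eigenspace X L \<theta> \<and> x \<noteq> 0"

definition is_eigenvalue ::
    "'i set \<Rightarrow> (('i \<Rightarrow> complex) \<Rightarrow> 'i \<Rightarrow> complex) \<Rightarrow> complex \<Rightarrow> bool" where
  "is_eigenvalue X L \<theta> \<longleftrightarrow> (\<exists>x. is_eigenvector X L \<theta> x)"

text \<open>The matrix with respect to the standard basis indexed by the distinct list \<open>xs\<close>.\<close>

definition op_mat :: "'i list \<Rightarrow> (('i \<Rightarrow> complex) \<Rightarrow> 'i \<Rightarrow> complex) \<Rightarrow> complex mat" where
  "op_mat xs L = mat (length xs) (length xs)
     (\<lambda>(i, j). L (\<lambda>k. if k = xs ! j then 1 else 0) (xs ! i))"

text \<open>The multiset of eigenvalues with algebraic multiplicities. The enumeration of the finite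
  set \<open>X\<close> is immaterial: another one conjugates the matrix by a permutation matrix.\<close>

definition spectrum_mset ::
    "'i set \<Rightarrow> (('i \<Rightarrow> complex) \<Rightarrow> 'i \<Rightarrow> complex) \<Rightarrow> complex multiset" where
  "spectrum_mset X L =
     proots (char_poly (op_mat (SOME xs. distinct xs \<and> set xs = X) L))"

section \<open>Hypergraphs, units and the general adjacency operator\<close>

definition hypergraph :: "'a set \<Rightarrow> 'a set set \<Rightarrow> bool" where
  "hypergraph V E \<longleftrightarrow> finite V \<and> V \<noteq> {} \<and> (\<forall>e\<in>E. e \<noteq> {} \<and> e \<subseteq> V)"

definition star :: "'a set set \<Rightarrow> 'a \<Rightarrow> 'a set set" where
  "star E v = {e \<in> E. v \<in> e}"

definition unit_rel :: "'a set \<Rightarrow> 'a set set \<Rightarrow> ('a \<times> 'a) set" where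
  "unit_rel V E = {(u, v). u \<in> V \<and> v \<in> V \<and> star E u = star E v}"

definition units :: "'a set \<Rightarrow> 'a set set \<Rightarrow> 'a set set" where
  "units V E = V // unit_rel V E"

definition unit_of_gen :: "'a set \<Rightarrow> 'a set set \<Rightarrow> 'a set set \<Rightarrow> 'a set" where
  "unit_of_gen V E F = {v \<in> V. star E v = F}"

text \<open>Units are non-empty, so each of them has exactly one generating set.\<close>

definition generating_set :: "'a set \<Rightarrow> 'a set set \<Rightarrow> 'a set \<Rightarrow> 'a set set" where
  "generating_set V E W = (THE F. F \<subseteq> E \<and> W = unit_of_gen V E F)"

definition adj_op ::
    "'a set \<Rightarrow> 'a set set \<Rightarrow> ('a \<Rightarrow> real) \<Rightarrow> ('a set \<Rightarrow> real) \<Rightarrow> ('a \<Rightarrow> complex) \<Rightarrow> 'a \<Rightarrow> complex" where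
  "adj_op V E \<delta>V \<delta>E x v =
     (if v \<in> V
      then \<Sum>e\<in>star E v. of_real (\<delta>E e / \<delta>V v * (1 / real (card e) ^ 2)) * (\<Sum>u\<in>e - {v}. x u)
      else 0)"

text \<open>\<open>c\<close> assigns to a generating set the common value of the vertex weight on its unit.
  \<open>contr_coeff V E c \<delta>E W' W\<close> is the coefficient $c^i_j$ for $W' = W_{E_i}$, $W = W_{E_j}$.\<close>

definition contr_coeff ::
    "'a set \<Rightarrow> 'a set set \<Rightarrow> ('a set set \<Rightarrow> real) \<Rightarrow> ('a set \<Rightarrow> real) \<Rightarrow> 'a set \<Rightarrow> 'a set \<Rightarrow> real" where
  "contr_coeff V E c \<delta>E W' W =
     (let F = generating_set V E W in
      if W' \<noteq> W
      then \<Sum>e\<in>F. \<delta>E e / c F * (1 / real (card e) ^ 2) * real (card (W' \<inter> e))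
      else \<Sum>e\<in>F. \<delta>E e / c F * (1 / real (card e) ^ 2) * (real (card (W \<inter> e)) - 1))"

definition contr_op ::
    "'a set \<Rightarrow> 'a set set \<Rightarrow> ('a set set \<Rightarrow> real) \<Rightarrow> ('a set \<Rightarrow> real) \<Rightarrow>
     ('a set \<Rightarrow> complex) \<Rightarrow> 'a set \<Rightarrow> complex" where
  "contr_op V E c \<delta>E y W =
     (if W \<in> units V E
      then \<Sum>W'\<in>units V E. of_real (contr_coeff V E c \<delta>E W' W) * y W'
      else 0)"

definition blow_up ::
    "'a set \<Rightarrow> 'a set set \<Rightarrow> ('a set \<Rightarrow> complex) \<Rightarrow> 'a \<Rightarrow> complex" where
  "blow_up V E y v = (if v \<in> V then y (unit_rel V E `` {v}) else 0)"

definition zero_sum_space :: "'a set \<Rightarrow> 'a set \<Rightarrow> ('a \<Rightarrow> complex) set" where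
  "zero_sum_space V U = {x \<in> fun_space V. {v \<in> V. x v \<noteq> 0} \<subseteq> U \<and> (\<Sum>v\<in>U. x v) = 0}"

definition unit_eigenvalue ::
    "'a set \<Rightarrow> 'a set set \<Rightarrow> ('a set set \<Rightarrow> real) \<Rightarrow> ('a set \<Rightarrow> real) \<Rightarrow> 'a set \<Rightarrow> complex" where
  "unit_eigenvalue V E c \<delta>E W =
     (let F = generating_set V E W in
      - of_real (\<Sum>e\<in>F. \<delta>E e / (c F * real (card e) ^ 2)))"

end

theory Submission
  imports Defs
begin

text \<open>
  Vertices of one unit lie in the same edges, so an edge that meets a unit contains it: every edge is
  a union of units. Two consequences determine the adjacency operator \<open>A\<close> completely. If \<open>z\<close> sums
  to zero on every unit, it also sums to zero on every edge, and the only thing left of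
  \<open>\<Sum>u\<in>e - {v}. z u\<close> is \<open>- z v\<close>; hence \<open>A\<close> multiplies \<open>z\<close> on each unit by the eigenvalue attached
  to that unit (\<open>adj_op_unitwise_zero_sum\<close>). If \<open>x\<close> is constant on units, say the blow up of \<open>y\<close>,
  then collecting the summands of an edge by units gives the blow up of the contraction applied to
  \<open>y\<close> (\<open>adj_op_blow\<close>).

  Subtracting from a function its mean on each unit shows that the function space on \<open>V\<close> is the
  direct sum of these two kinds of functions, so \<open>A\<close> is the direct sum of scalar operators on the
  spaces \<open>S_W\<close> and of a copy of the contraction. A concrete basis adapted to the sum is used
  throughout: fix a representative in each unit, and take the differences \<open>delta v - delta r\<close>, where
  \<open>v\<close> is not a representative and \<open>r\<close> represents its unit, together with the blow ups of a basis of
  the functions on the set of units. A unit \<open>W\<close> contributes \<open>card W - 1\<close> differences. In this basis the matrix of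
  \<open>A\<close> is block diagonal, with a diagonal block and the matrix of the contraction, which yields the
  algebraic multiplicities (\<open>spectrum_adj_op\<close>); intersecting the decomposition with an eigenspace
  yields the geometric ones (\<open>eigenspace_decomposition\<close>, \<open>dim_eigenspace\<close>).
\<close>

section \<open>Complex functions with finite support\<close>

definition delta :: "'i \<Rightarrow> 'i \<Rightarrow> complex" where
  "delta v = (\<lambda>k. if k = v then 1 else 0)"

lemma delta_in_fun_space: "v \<in> X \<Longrightarrow> delta v \<in> fun_space X"
  by (auto simp: delta_def fun_space_def)

lemma sum_fun_apply: "(\<Sum>i\<in>I. f i) k = (\<Sum>i\<in>I. f i k)"
  by (induction I rule: infinite_finite_induct) auto

lemma sum_mult_delta: "finite X \<Longrightarrow> (\<Sum>v\<in>X. f v * delta v k) = (if k \<in> X then f k else 0)"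
  by (simp add: delta_def if_distrib[of "\<lambda>t. _ * t"] cong: if_cong)

lemma sum_delta: "finite X \<Longrightarrow> (\<Sum>k\<in>X. delta v k) = (if v \<in> X then 1 else 0)"
  by (simp add: delta_def)

lemma fun_space_expansion:
  assumes "finite X" "x \<in> fun_space X"
  shows "x = (\<Sum>v\<in>X. fscale (x v) (delta v))"
proof
  fix k
  show "x k = (\<Sum>v\<in>X. fscale (x v) (delta v)) k"
    using assms by (simp add: sum_fun_apply fscale_def sum_mult_delta fun_space_def)
qed

lemma subspace_fun_space: "cfun.subspace (fun_space X)"
  by (auto simp: cfun.subspace_def fun_space_def fscale_def)

lemma fun_space_subset_span_delta:
  assumes "finite X" shows "fun_space X \<subseteq> cfun.span (delta ` X)"
proof
  fix x assume "x \<in> fun_space X"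
  then have "x = (\<Sum>v\<in>X. fscale (x v) (delta v))"
    by (rule fun_space_expansion[OF assms])
  also have "\<dots> \<in> cfun.span (delta ` X)"
    by (intro cfun.span_sum cfun.span_scale cfun.span_base) simp
  finally show "x \<in> cfun.span (delta ` X)" .
qed

lemma finite_independent_fun_space:
  assumes "finite X" "B \<subseteq> fun_space X" "cfun.independent B"
  shows "finite B"
  using cfun.independent_span_bound[of "delta ` X" B] assms fun_space_subset_span_delta[of X]
  by auto

text \<open>Evaluating a vanishing combination at \<open>i\<close> isolates the coefficient of \<open>b i\<close>.\<close>

lemma independent_by_coordinates:
  assumes fin: "finite I"
    and one: "\<And>i. i \<in> I \<Longrightarrow> b i i = 1"
    and zero: "\<And>i j. i \<in> I \<Longrightarrow> j \<in> I \<Longrightarrow> i \<noteq> j \<Longrightarrow> b i j = 0"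
  shows "inj_on b I" "cfun.independent (b ` I)"
proof -
  show inj: "inj_on b I"
    by (rule inj_onI) (metis one zero zero_neq_one)
  show "cfun.independent (b ` I)"
  proof (rule cfun.independent_if_scalars_zero)
    fix f x
    assume "(\<Sum>x\<in>b ` I. fscale (f x) x) = 0" and x: "x \<in> b ` I"
    then have s: "(\<Sum>i\<in>I. fscale (f (b i)) (b i)) = 0"
      using inj by (simp add: sum.reindex)
    from x obtain j where j: "j \<in> I" "x = b j" by blast
    have "0 = (\<Sum>i\<in>I. f (b i) * b i j)"
      using fun_cong[OF s, of j] by (simp add: sum_fun_apply fscale_def)
    also have "\<dots> = (\<Sum>i\<in>I. if i = j then f (b i) else 0)"
      using one zero j by (intro sum.cong) auto
    also have "\<dots> = f x" using j fin by simp
    finally show "f x = 0" by simp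
  qed (use fin in simp)
qed

lemma independent_delta: "finite X \<Longrightarrow> inj_on delta X" "finite X \<Longrightarrow> cfun.independent (delta ` X)"
  by (rule independent_by_coordinates; simp add: delta_def)+

lemma (in vector_space) independent_Un:
  assumes A: "independent A" and B: "independent B" and AB: "span A \<inter> span B \<subseteq> {0}"
  shows "A \<inter> B = {}" "independent (A \<union> B)"
proof -
  show dis: "A \<inter> B = {}"
    using AB A span_base dependent_zero by blast
  show "independent (A \<union> B)"
    unfolding independent_explicit_module
  proof (intro allI impI)
    fix t u v
    assume t: "finite t" "t \<subseteq> A \<union> B" and s: "(\<Sum>v\<in>t. scale (u v) v) = 0" and v: "v \<in> t"
    let ?a = "\<Sum>v\<in>t \<inter> A. scale (u v) v" and ?b = "\<Sum>v\<in>t \<inter> B. scale (u v) v"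
    have "?a + ?b = (\<Sum>v\<in>(t \<inter> A) \<union> (t \<inter> B). scale (u v) v)"
      using t dis by (intro sum.union_disjoint[symmetric]) auto
    also have "(t \<inter> A) \<union> (t \<inter> B) = t" using t by blast
    finally have ab: "?a + ?b = 0" using s by simp
    have "?a \<in> span A" by (rule span_sum, rule span_scale, rule span_base) simp
    moreover have "- ?b \<in> span B"
      by (rule span_neg, rule span_sum, rule span_scale, rule span_base) simp
    moreover have "?a = - ?b" using ab by (simp only: eq_neg_iff_add_eq_0)
    ultimately have "?a \<in> span A \<inter> span B" by (simp only: Int_iff)
    then have a0: "?a = 0" using AB by blast
    then have b0: "?b = 0" using ab by simp
    show "u v = 0"
    proof (cases "v \<in> A")
      case True
      then show ?thesis using independentD[OF A _ _ a0] t v by blast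
    next
      case False
      then show ?thesis using independentD[OF B _ _ b0] t v by blast
    qed
  qed
qed

section \<open>The spectrum in an arbitrary basis\<close>

text \<open>The matrix with the basis vectors as its columns conjugates the matrix of the operator in the
  standard basis into its matrix in the new basis.\<close>

lemma spectrum_mset_change_of_basis:
  assumes fin: "finite X" and lin: "Vector_Spaces.linear fscale fscale L"
    and bs: "set bs \<subseteq> fun_space X" "distinct bs" "length bs = card X" "cfun.independent (set bs)"
    and B: "B \<in> carrier_mat (card X) (card X)"
    and LB: "\<And>j. j < card X \<Longrightarrow> L (bs ! j) = (\<Sum>i<card X. fscale (B $$ (i, j)) (bs ! i))"
  shows "spectrum_mset X L = proots (char_poly B)"
proof -
  interpret L: Vector_Spaces.linear fscale fscale L by fact
  define xs where "xs = (SOME xs. distinct xs \<and> set xs = X)"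
  have xs: "distinct xs" "set xs = X"
    using someI_ex[of "\<lambda>xs. distinct xs \<and> set xs = X"] finite_distinct_list[OF fin]
    unfolding xs_def by auto
  define n where "n = card X"
  have lx: "length xs = n" using xs distinct_card n_def by fastforce
  have bij: "bij_betw (\<lambda>i. xs ! i) {..<n} X"
    using bij_betw_nth[OF xs(1)] xs(2) lx by simp
  define A where "A = op_mat xs L"
  define P where "P = mat n n (\<lambda>(i, j). (bs ! j) (xs ! i))"
  have A: "A \<in> carrier_mat n n" and P: "P \<in> carrier_mat n n" and B: "B \<in> carrier_mat n n"
    using B by (simp_all add: A_def op_mat_def lx P_def n_def)
  have AP: "A * P = P * B"
  proof (rule eq_matI)
    fix i j assume "i < dim_row (P * B)" "j < dim_col (P * B)"
    then have i: "i < n" and j: "j < n" using P B by auto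
    have mem: "bs ! j \<in> fun_space X" using bs j n_def by auto
    have "(A * P) $$ (i, j) = (\<Sum>k<n. L (delta (xs ! k)) (xs ! i) * (bs ! j) (xs ! k))"
      using A P i j by (simp add: times_mat_def scalar_prod_def A_def P_def op_mat_def lx delta_def
          atLeast0LessThan)
    also have "\<dots> = (\<Sum>v\<in>X. L (delta v) (xs ! i) * (bs ! j) v)"
      using sum.reindex_bij_betw[OF bij] .
    also have "\<dots> = (\<Sum>v\<in>X. fscale ((bs ! j) v) (L (delta v))) (xs ! i)"
      by (simp add: sum_fun_apply fscale_def mult.commute)
    also have "(\<Sum>v\<in>X. fscale ((bs ! j) v) (L (delta v))) = L (\<Sum>v\<in>X. fscale ((bs ! j) v) (delta v))"
      by (simp add: L.sum L.scale)
    also have "\<dots> = L (bs ! j)"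
      using fun_space_expansion[OF fin mem] by simp
    also have "\<dots> (xs ! i) = (\<Sum>k<n. (bs ! k) (xs ! i) * B $$ (k, j))"
      using j by (simp add: LB n_def sum_fun_apply fscale_def mult.commute)
    also have "\<dots> = (P * B) $$ (i, j)"
      using P B i j by (simp add: times_mat_def scalar_prod_def P_def atLeast0LessThan)
    finally show "(A * P) $$ (i, j) = (P * B) $$ (i, j)" .
  qed (use A P B in auto)
  \<comment> \<open>A vector in the kernel of \<open>P\<close> is a linear relation between the basis vectors.\<close>
  have "det P \<noteq> 0"
  proof
    assume "det P = 0"
    then obtain v where v: "v \<in> carrier_vec n" "v \<noteq> 0\<^sub>v n" "P *\<^sub>v v = 0\<^sub>v n"
      using det_0_iff_vec_prod_zero_field[OF P] by blast
    let ?s = "\<Sum>j<n. fscale (v $ j) (bs ! j)"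
    have s: "?s \<in> fun_space X"
      using bs n_def
      by (intro cfun.subspace_sum cfun.subspace_scale subspace_fun_space) auto
    have "?s x = 0" for x
    proof (cases "x \<in> X")
      case True
      then obtain i where i: "i < n" "x = xs ! i" using bij by (auto simp: bij_betw_def)
      have "?s x = (P *\<^sub>v v) $ i"
        using P v(1) i by (simp add: sum_fun_apply fscale_def P_def scalar_prod_def atLeast0LessThan
            mult.commute)
      then show ?thesis using v i by simp
    qed (use s in \<open>simp add: fun_space_def\<close>)
    then have s0: "?s = 0" by (simp add: fun_eq_iff)
    have bijb: "bij_betw (\<lambda>j. bs ! j) {..<n} (set bs)"
      using bij_betw_nth[OF bs(2)] bs(3) n_def by simp
    define u where "u b = v $ (the_inv_into {..<n} (\<lambda>j. bs ! j) b)" for b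
    have u: "u (bs ! j) = v $ j" if "j < n" for j
      using that bijb by (simp add: u_def the_inv_into_f_f bij_betw_def)
    have "(\<Sum>b\<in>set bs. fscale (u b) b) = ?s"
      using sum.reindex_bij_betw[OF bijb, of "\<lambda>b. fscale (u b) b"] u by simp
    then have "u (bs ! j) = 0" if "j < n" for j
      using cfun.independentD[OF bs(4), of "set bs" u "bs ! j"] s0 that bs(3) n_def by simp
    then have "v = 0\<^sub>v n" using u v(1) by (intro eq_vecI) auto
    then show False using v by simp
  qed
  then obtain Q where Q: "Q \<in> carrier_mat n n" "P * Q = 1\<^sub>m n" "Q * P = 1\<^sub>m n"
    using det_non_zero_imp_unit[OF P, of "()"]
    by (auto simp: Units_def ring_mat_def)
  have "A = A * (P * Q)" using A Q by simp
  also have "\<dots> = A * P * Q" using A P Q by simp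
  also have "\<dots> = P * B * Q" by (simp add: AP)
  finally have "similar_mat A B"
    using A B P Q by (intro similar_matI[of A B P Q n]) auto
  then show ?thesis
    unfolding spectrum_mset_def using char_poly_similar[of A B] by (simp add: A_def xs_def)
qed

lemma char_poly_four_block_diag:
  fixes A :: "'a :: idom mat"
  assumes A: "A \<in> carrier_mat n n" and D: "D \<in> carrier_mat m m"
  shows "char_poly (four_block_mat A (0\<^sub>m n m) (0\<^sub>m m n) D) = char_poly A * char_poly D"
proof -
  have "char_poly_matrix (four_block_mat A (0\<^sub>m n m) (0\<^sub>m m n) D)
      = four_block_mat (char_poly_matrix A) (0\<^sub>m n m) (0\<^sub>m m n) (char_poly_matrix D)"
    using A D by (intro eq_matI) (auto simp: char_poly_matrix_def)
  then show ?thesis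
    using A D unfolding char_poly_def
    by (simp add: det_four_block_mat_lower_left_zero[of _ n _ m])
qed

lemma proots_char_poly_diag:
  fixes f :: "nat \<Rightarrow> 'a :: idom"
  shows "proots (char_poly (mat n n (\<lambda>(i, j). if i = j then f i else 0))) = mset (map f [0..<n])"
proof -
  let ?D = "mat n n (\<lambda>(i, j). if i = j then f i else 0)"
  have "char_poly ?D = (\<Prod>a \<leftarrow> diag_mat ?D. [:- a, 1:])"
    by (rule char_poly_upper_triangular[of _ n]) (auto simp: upper_triangular_def)
  also have "diag_mat ?D = map f [0..<n]" by (auto simp: diag_mat_def)
  finally have cp: "char_poly ?D = (\<Prod>a \<leftarrow> map f [0..<n]. [:- a, 1:])" .
  have "proots (\<Prod>a \<leftarrow> as. [:- a, 1:]) = mset as" for as :: "'a list"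
  proof (induction as)
    case (Cons a as)
    have "(\<Prod>a \<leftarrow> as. [:- a, 1:]) \<noteq> (0 :: 'a poly)" by (auto simp: prod_list_zero_iff)
    then have "proots (\<Prod>a \<leftarrow> a # as. [:- a, 1:]) = proots [:- a, 1:] + mset as"
      using Cons.IH by (simp add: proots_mult del: mult_pCons_left)
    then show ?case by simp
  qed simp
  then show ?thesis unfolding cp .
qed

section \<open>Units\<close>

locale finite_hypergraph =
  fixes V :: "'a set" and E :: "'a set set"
  assumes hyp: "hypergraph V E"
begin

definition unit_of :: "'a \<Rightarrow> 'a set" where
  "unit_of v = unit_rel V E `` {v}"

definition rep :: "'a set \<Rightarrow> 'a" where
  "rep W = (SOME v. v \<in> W)"

text \<open>These vertices index the differences in the adapted basis.\<close>

definition nonreps :: "'a set" where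
  "nonreps = {v \<in> V. rep (unit_of v) \<noteq> v}"

lemma finite_V: "finite V" and edge_subset: "e \<in> E \<Longrightarrow> e \<subseteq> V"
  using hyp by (auto simp: hypergraph_def)

lemma finite_edge: "e \<in> E \<Longrightarrow> finite e"
  using finite_V edge_subset finite_subset by blast

lemma mem_unit_of: "v \<in> V \<Longrightarrow> u \<in> unit_of v \<longleftrightarrow> u \<in> V \<and> star E u = star E v"
  by (auto simp: unit_of_def unit_rel_def)

lemma units_eq: "units V E = unit_of ` V"
  by (auto simp: units_def quotient_def unit_of_def)

lemma finite_units: "finite (units V E)"
  by (simp add: units_eq finite_V)

lemma unit_of_in_units: "v \<in> V \<Longrightarrow> unit_of v \<in> units V E"
  by (simp add: units_eq)

lemma self_in_unit_of: "v \<in> V \<Longrightarrow> v \<in> unit_of v"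
  by (simp add: mem_unit_of)

lemma unit_subset: "W \<in> units V E \<Longrightarrow> W \<subseteq> V"
  by (auto simp: units_eq mem_unit_of)

lemma finite_unit: "W \<in> units V E \<Longrightarrow> finite W"
  using unit_subset finite_V finite_subset by blast

lemma unit_of_eq: "W \<in> units V E \<Longrightarrow> v \<in> W \<Longrightarrow> unit_of v = W"
  by (auto simp: units_eq mem_unit_of set_eq_iff)

lemma unit_disjoint: "W \<in> units V E \<Longrightarrow> W' \<in> units V E \<Longrightarrow> W \<noteq> W' \<Longrightarrow> W \<inter> W' = {}"
  using unit_of_eq by blast

lemma unit_nonempty: "W \<in> units V E \<Longrightarrow> W \<noteq> {}"
  using self_in_unit_of by (auto simp: units_eq)

lemma card_unit_pos: "W \<in> units V E \<Longrightarrow> card W > 0"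
  using finite_unit unit_nonempty by (simp add: card_gt_0_iff)

lemma rep_in_unit: "W \<in> units V E \<Longrightarrow> rep W \<in> W"
  using unit_nonempty by (simp add: rep_def some_in_eq)

lemma nonreps_Int_unit: "W \<in> units V E \<Longrightarrow> nonreps \<inter> W = W - {rep W}"
  using unit_of_eq unit_subset by (fastforce simp: nonreps_def)

lemma card_nonreps_Int_unit: "W \<in> units V E \<Longrightarrow> card (nonreps \<inter> W) = card W - 1"
  by (simp add: nonreps_Int_unit rep_in_unit)

lemma finite_nonreps: "finite nonreps"
  by (simp add: nonreps_def finite_V)

lemma card_nonreps_by_unit:
  "card {v \<in> nonreps. P (unit_of v)} = (\<Sum>W\<in>{W \<in> units V E. P W}. card W - 1)"
proof -
  have "{v \<in> nonreps. P (unit_of v)} = (\<Union>W\<in>{W \<in> units V E. P W}. nonreps \<inter> W)"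
  proof (rule equalityI; rule subsetI)
    fix v assume "v \<in> {v \<in> nonreps. P (unit_of v)}"
    then have "v \<in> nonreps" "v \<in> V" "P (unit_of v)" by (auto simp: nonreps_def)
    then show "v \<in> (\<Union>W\<in>{W \<in> units V E. P W}. nonreps \<inter> W)"
      by (intro UN_I[of "unit_of v"]) (simp_all add: unit_of_in_units self_in_unit_of)
  qed (auto simp: unit_of_eq)
  also have "card \<dots> = (\<Sum>W\<in>{W \<in> units V E. P W}. card (nonreps \<inter> W))"
  proof (rule card_UN_disjoint)
    show "\<forall>i\<in>{W \<in> units V E. P W}. \<forall>j\<in>{W \<in> units V E. P W}.
        i \<noteq> j \<longrightarrow> nonreps \<inter> i \<inter> (nonreps \<inter> j) = {}"
      using unit_disjoint by blast
  qed (simp_all add: finite_units finite_nonreps)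
  also have "\<dots> = (\<Sum>W\<in>{W \<in> units V E. P W}. card W - 1)"
    by (intro sum.cong) (auto simp: card_nonreps_Int_unit)
  finally show ?thesis .
qed

lemma sum_by_units:
  assumes "S \<subseteq> V"
  shows "sum f S = (\<Sum>W\<in>units V E. sum f (W \<inter> S))"
proof -
  have "S = (\<Union>W\<in>units V E. W \<inter> S)"
    using assms self_in_unit_of unit_of_in_units by blast
  then have "sum f S = sum f (\<Union>W\<in>units V E. W \<inter> S)" by simp
  also have "\<dots> = (\<Sum>W\<in>units V E. sum f (W \<inter> S))"
  proof (rule sum.UNION_disjoint)
    show "\<forall>i\<in>units V E. \<forall>j\<in>units V E. i \<noteq> j \<longrightarrow> i \<inter> S \<inter> (j \<inter> S) = {}"
      using unit_disjoint by blast
  qed (simp_all add: finite_units finite_unit)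
  finally show ?thesis .
qed

text \<open>The reason for everything below: the vertices of a unit have the same star, so an edge through
  one of them passes through all of them.\<close>

lemma unit_Int_edge: "W \<in> units V E \<Longrightarrow> e \<in> E \<Longrightarrow> W \<inter> e \<noteq> {} \<Longrightarrow> W \<subseteq> e"
  by (auto simp: units_eq mem_unit_of star_def) blast

lemma generating_set_unit_of:
  assumes v: "v \<in> V"
  shows "generating_set V E (unit_of v) = star E v"
  unfolding generating_set_def
proof (rule the_equality)
  show "star E v \<subseteq> E \<and> unit_of v = unit_of_gen V E (star E v)"
    using v by (auto simp: star_def unit_of_gen_def unit_of_def unit_rel_def)
next
  fix F assume "F \<subseteq> E \<and> unit_of v = unit_of_gen V E F"
  then show "F = star E v"
    using self_in_unit_of[OF v] by (auto simp: unit_of_gen_def)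
qed

section \<open>Functions that sum to zero on each unit, and blow ups\<close>

text \<open>The direct sum of the spaces \<open>zero_sum_space V W\<close> over all units \<open>W\<close>.\<close>

definition unitwise_zero_sum :: "('a \<Rightarrow> complex) set" where
  "unitwise_zero_sum = {x \<in> fun_space V. \<forall>W\<in>units V E. sum x W = 0}"

definition unit_mean :: "('a \<Rightarrow> complex) \<Rightarrow> 'a set \<Rightarrow> complex" where
  "unit_mean x W = (if W \<in> units V E then sum x W / of_nat (card W) else 0)"

definition unit_diff :: "'a \<Rightarrow> 'a \<Rightarrow> complex" where
  "unit_diff v = delta v - delta (rep (unit_of v))"

abbreviation blow :: "('a set \<Rightarrow> complex) \<Rightarrow> 'a \<Rightarrow> complex" where
  "blow \<equiv> blow_up V E"

lemma blow_apply: "blow y v = (if v \<in> V then y (unit_of v) else 0)"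
  by (simp add: blow_up_def unit_of_def)

lemma blow_in_fun_space: "blow y \<in> fun_space V"
  by (simp add: blow_apply fun_space_def)

lemma linear_blow: "Vector_Spaces.linear fscale fscale blow"
  unfolding Vector_Spaces.linear_iff
  by (intro conjI cfun.vector_space_axioms) (auto simp: blow_apply fscale_def fun_eq_iff)

lemma sum_blow_unit: "W \<in> units V E \<Longrightarrow> sum (blow y) W = of_nat (card W) * y W"
  using unit_of_eq unit_subset by (simp add: blow_apply subset_iff)

lemma subspace_unitwise_zero_sum: "cfun.subspace unitwise_zero_sum"
  by (auto simp: cfun.subspace_def unitwise_zero_sum_def fun_space_def fscale_def sum.distrib
      simp flip: sum_distrib_left)

lemma minus_mean_in_unitwise_zero_sum:
  assumes "x \<in> fun_space V"
  shows "x - blow (unit_mean x) \<in> unitwise_zero_sum"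
  using assms blow_in_fun_space[of "unit_mean x"] card_unit_pos
  by (auto simp: unitwise_zero_sum_def fun_space_def sum_subtractf sum_blow_unit unit_mean_def)

lemma unit_mean_in_fun_space: "unit_mean x \<in> fun_space (units V E)"
  by (simp add: unit_mean_def fun_space_def)

text \<open>The two summands of the function space meet only in zero: a function that is constant on a unit
  sums to a nonzero multiple of its value there. The conclusion also gives the injectivity of
  blowing up.\<close>

lemma blow_in_unitwise_zero_sum:
  assumes y: "y \<in> fun_space (units V E)" and z: "blow y \<in> unitwise_zero_sum"
  shows "y = 0"
proof
  fix W
  show "y W = 0 W"
  proof (cases "W \<in> units V E")
    case True
    then show ?thesis
      using z sum_blow_unit[of W y] card_unit_pos[of W] by (auto simp: unitwise_zero_sum_def)
  qed (use y in \<open>simp add: fun_space_def\<close>)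
qed

lemma inj_on_blow: "inj_on blow (fun_space (units V E))"
proof (rule inj_onI)
  interpret b: Vector_Spaces.linear fscale fscale blow by (rule linear_blow)
  fix y y' assume y: "y \<in> fun_space (units V E)" "y' \<in> fun_space (units V E)" "blow y = blow y'"
  have "blow (y - y') \<in> unitwise_zero_sum"
    using y by (simp add: b.diff cfun.subspace_0[OF subspace_unitwise_zero_sum])
  moreover have "y - y' \<in> fun_space (units V E)"
    using y by (intro cfun.subspace_diff subspace_fun_space)
  ultimately show "y = y'" using blow_in_unitwise_zero_sum[of "y - y'"] by simp
qed

lemma unit_diff_in_unitwise_zero_sum:
  assumes v: "v \<in> V"
  shows "unit_diff v \<in> unitwise_zero_sum"
proof -
  have r: "rep (unit_of v) \<in> unit_of v" using v by (simp add: rep_in_unit unit_of_in_units)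
  have "unit_diff v \<in> fun_space V"
    using r v unfolding unit_diff_def
    by (intro cfun.subspace_diff subspace_fun_space delta_in_fun_space) (auto simp: mem_unit_of)
  moreover have "sum (unit_diff v) W = 0" if W: "W \<in> units V E" for W
  proof -
    have "v \<in> W \<longleftrightarrow> rep (unit_of v) \<in> W"
      using W unit_of_eq r self_in_unit_of[OF v] unit_of_in_units[OF v] by metis
    then show ?thesis
      using finite_unit[OF W] by (simp add: unit_diff_def sum_subtractf sum_delta)
  qed
  ultimately show ?thesis by (simp add: unitwise_zero_sum_def)
qed

text \<open>The vertex where \<open>unit_diff v\<close> is negative is a representative, so the coordinates at
  non-representatives do not see it.\<close>

lemma unit_diff_nonrep:
  assumes "v \<in> nonreps" "k \<in> nonreps"
  shows "unit_diff v k = delta v k"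
proof -
  have v: "v \<in> V" using assms by (simp add: nonreps_def)
  then have "unit_of (rep (unit_of v)) = unit_of v"
    by (simp add: unit_of_eq unit_of_in_units rep_in_unit)
  then have "k \<noteq> rep (unit_of v)" using assms(2) by (auto simp: nonreps_def)
  then show ?thesis by (simp add: unit_diff_def delta_def)
qed

lemma unit_diff_independent:
  assumes "N \<subseteq> nonreps"
  shows "inj_on unit_diff N" "cfun.independent (unit_diff ` N)"
proof -
  have "finite N" using assms finite_nonreps finite_subset by blast
  moreover have "unit_diff u v = (if u = v then 1 else 0)" if "u \<in> N" "v \<in> N" for u v
    using assms that by (auto simp: unit_diff_nonrep subset_iff delta_def)
  ultimately show "inj_on unit_diff N" "cfun.independent (unit_diff ` N)"
    using independent_by_coordinates[of N unit_diff] by simp_all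
qed

text \<open>The zero sum recovers the value at the representative from the other values in its unit.\<close>

lemma unitwise_zero_sum_vanish:
  assumes z: "z \<in> unitwise_zero_sum" and W: "W \<in> units V E"
    and zero: "\<And>v. v \<in> nonreps \<inter> W \<Longrightarrow> z v = 0" and v: "v \<in> W"
  shows "z v = 0"
proof -
  have "0 = sum z W" using z W by (simp add: unitwise_zero_sum_def)
  also have "\<dots> = z (rep W) + sum z (W - {rep W})"
    using finite_unit[OF W] rep_in_unit[OF W] by (rule sum.remove)
  also have "sum z (W - {rep W}) = 0"
    using zero W by (intro sum.neutral) (simp flip: nonreps_Int_unit)
  finally have "z (rep W) = 0" by simp
  then show ?thesis using zero v W nonreps_Int_unit[OF W] by (cases "v = rep W") auto
qed

text \<open>Allowing any set of non-representatives serves twice: the non-representatives in one unit give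
  the space \<open>S_W\<close>, those in all units with a common eigenvalue give a part of an eigenspace. The
  coefficient of \<open>unit_diff v\<close> in \<open>z\<close> must be \<open>z v\<close>; the difference of the two sides then vanishes at
  all non-representatives, hence everywhere.\<close>

lemma span_unit_diff:
  assumes N: "N \<subseteq> nonreps"
  shows "cfun.span (unit_diff ` N) = {z \<in> unitwise_zero_sum. \<forall>v\<in>nonreps - N. z v = 0}" (is "_ = ?Z")
proof
  have fin: "finite N" using N finite_nonreps finite_subset by blast
  show "cfun.span (unit_diff ` N) \<subseteq> ?Z"
  proof (rule cfun.span_minimal)
    have "cfun.subspace {z. \<forall>v\<in>nonreps - N. z v = 0}"
      by (auto simp: cfun.subspace_def fscale_def)
    from cfun.subspace_inter[OF subspace_unitwise_zero_sum this]
    show "cfun.subspace ?Z" by (simp add: Int_def)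
    show "unit_diff ` N \<subseteq> ?Z"
      using N unit_diff_in_unitwise_zero_sum
      by (auto simp: subset_iff unit_diff_nonrep delta_def) (auto simp: nonreps_def)
  qed
  show "?Z \<subseteq> cfun.span (unit_diff ` N)"
  proof
    fix z assume z: "z \<in> ?Z"
    define s where "s = (\<Sum>v\<in>N. fscale (z v) (unit_diff v))"
    have s: "s \<in> cfun.span (unit_diff ` N)"
      unfolding s_def by (intro cfun.span_sum cfun.span_scale cfun.span_base) simp
    have "s \<in> unitwise_zero_sum"
      using \<open>cfun.span (unit_diff ` N) \<subseteq> ?Z\<close> s by blast
    then have d: "z - s \<in> unitwise_zero_sum"
      using z by (simp add: cfun.subspace_diff[OF subspace_unitwise_zero_sum])
    have nr: "(z - s) k = 0" if k: "k \<in> nonreps" for k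
    proof -
      have "s k = (\<Sum>v\<in>N. z v * delta v k)"
        using N k by (auto simp: s_def sum_fun_apply fscale_def unit_diff_nonrep intro!: sum.cong)
      then show ?thesis using z k fin by (simp add: sum_mult_delta)
    qed
    have "z k = s k" for k
    proof (cases "k \<in> V")
      case True
      then show ?thesis
        using unitwise_zero_sum_vanish[OF d, of "unit_of k" k] nr
        by (simp add: unit_of_in_units self_in_unit_of)
    next
      case False
      then show ?thesis using d by (auto simp: unitwise_zero_sum_def fun_space_def)
    qed
    then have "z = s" by (simp add: fun_eq_iff)
    then show "z \<in> cfun.span (unit_diff ` N)" using s by simp
  qed
qed

text \<open>The independence of the adapted basis. For \<open>B\<close> one takes the standard basis to compute the
  characteristic polynomial, and a basis of an eigenspace of the contraction to compute dimensions.\<close>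

lemma independent_unit_diff_blow:
  assumes N: "N \<subseteq> nonreps" and B: "B \<subseteq> fun_space (units V E)" "cfun.independent B"
  shows "unit_diff ` N \<inter> blow ` B = {}" "cfun.independent (unit_diff ` N \<union> blow ` B)"
proof -
  interpret b: Vector_Spaces.linear fscale fscale blow by (rule linear_blow)
  have spB: "cfun.span B \<subseteq> fun_space (units V E)"
    using B subspace_fun_space by (intro cfun.span_minimal)
  have ib: "cfun.independent (blow ` B)"
    using B inj_on_subset[OF inj_on_blow spB] by (intro b.independent_injective_image)
  have "cfun.span (unit_diff ` N) \<inter> cfun.span (blow ` B) \<subseteq> {0}"
  proof
    fix x assume "x \<in> cfun.span (unit_diff ` N) \<inter> cfun.span (blow ` B)"
    then obtain y where y: "y \<in> cfun.span B" "x = blow y" "x \<in> unitwise_zero_sum"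
      by (auto simp: span_unit_diff[OF N] b.span_image)
    then have "y = 0" using blow_in_unitwise_zero_sum spB by blast
    then show "x \<in> {0}" using y by simp
  qed
  from cfun.independent_Un[OF unit_diff_independent(2)[OF N] ib this]
  show "unit_diff ` N \<inter> blow ` B = {}" "cfun.independent (unit_diff ` N \<union> blow ` B)" .
qed

lemma zero_sum_space_eq_span:
  assumes W: "W \<in> units V E"
  shows "zero_sum_space V W = cfun.span (unit_diff ` (nonreps \<inter> W))"
proof -
  have "zero_sum_space V W = {z \<in> unitwise_zero_sum. \<forall>v\<in>nonreps - nonreps \<inter> W. z v = 0}" (is "_ = ?Z")
  proof
    show "zero_sum_space V W \<subseteq> ?Z"
    proof
      fix z assume z: "z \<in> zero_sum_space V W"
      have off: "z v = 0" if "v \<notin> W" for v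
        using z that by (auto simp: zero_sum_space_def fun_space_def)
      have "sum z W' = 0" if "W' \<in> units V E" for W'
      proof (cases "W' = W")
        case False
        then have "z v = 0" if "v \<in> W'" for v
          using unit_disjoint[OF W \<open>W' \<in> _\<close>] that off by blast
        then show ?thesis by simp
      qed (use z in \<open>simp add: zero_sum_space_def\<close>)
      then show "z \<in> ?Z" using z off by (auto simp: unitwise_zero_sum_def zero_sum_space_def)
    qed
    show "?Z \<subseteq> zero_sum_space V W"
    proof
      fix z assume z: "z \<in> ?Z"
      have "z v = 0" if "v \<in> V" "v \<notin> W" for v
      proof (rule unitwise_zero_sum_vanish[of z "unit_of v"])
        fix u assume "u \<in> nonreps \<inter> unit_of v"
        then show "z u = 0"
          using z that unit_of_eq[OF W] unit_of_eq[of "unit_of v" u] unit_of_in_units self_in_unit_of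
          by fastforce
      qed (use z that unit_of_in_units self_in_unit_of in auto)
      then show "z \<in> zero_sum_space V W"
        using z W by (auto simp: zero_sum_space_def unitwise_zero_sum_def)
    qed
  qed
  then show ?thesis by (simp add: span_unit_diff)
qed

end

section \<open>The adjacency operator\<close>

locale unit_weighted_hypergraph = finite_hypergraph V E
  for V :: "'a set" and E :: "'a set set" +
  fixes \<delta>V :: "'a \<Rightarrow> real" and \<delta>E :: "'a set \<Rightarrow> real" and c :: "'a set set \<Rightarrow> real"
  assumes weight: "\<forall>W\<in>units V E. \<forall>v\<in>W. \<delta>V v = c (generating_set V E W)"
begin

abbreviation A :: "('a \<Rightarrow> complex) \<Rightarrow> 'a \<Rightarrow> complex" where
  "A \<equiv> adj_op V E \<delta>V \<delta>E"

abbreviation contr :: "('a set \<Rightarrow> complex) \<Rightarrow> 'a set \<Rightarrow> complex" where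
  "contr \<equiv> contr_op V E c \<delta>E"

abbreviation \<mu> :: "'a set \<Rightarrow> complex" where
  "\<mu> \<equiv> unit_eigenvalue V E c \<delta>E"

definition edge_weight :: "'a \<Rightarrow> 'a set \<Rightarrow> real" where
  "edge_weight v e = \<delta>E e / \<delta>V v * (1 / real (card e) ^ 2)"

lemma c_star: "v \<in> V \<Longrightarrow> c (star E v) = \<delta>V v"
  using weight unit_of_in_units self_in_unit_of generating_set_unit_of by metis

lemma unit_eigenvalue_unit_of:
  "v \<in> V \<Longrightarrow> \<mu> (unit_of v) = - (\<Sum>e\<in>star E v. of_real (edge_weight v e))"
  by (simp add: unit_eigenvalue_def generating_set_unit_of c_star edge_weight_def)

text \<open>Both cases of the coefficient count the vertices of \<open>W \<inter> e\<close> other than \<open>v\<close>, because the edges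
  in the star of \<open>v\<close> contain \<open>v\<close>, and \<open>v\<close> lies in no unit but its own.\<close>

lemma contr_coeff_unit_of:
  assumes "v \<in> V"
  shows "contr_coeff V E c \<delta>E W (unit_of v)
    = (\<Sum>e\<in>star E v. edge_weight v e * (real (card (W \<inter> e)) - (if W = unit_of v then 1 else 0)))"
  using assms
  by (simp add: contr_coeff_def Let_def generating_set_unit_of c_star edge_weight_def)

lemma adj_op_alt:
  assumes "v \<in> V"
  shows "A x v = (\<Sum>e\<in>star E v. of_real (edge_weight v e) * ((\<Sum>u\<in>e. x u) - x v))"
  unfolding adj_op_def edge_weight_def
  using assms finite_edge by (auto simp: star_def sum_diff1 intro!: sum.cong)

lemma adj_op_in_fun_space: "A x \<in> fun_space V"
  by (simp add: adj_op_def fun_space_def)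

lemma contr_op_in_fun_space: "contr y \<in> fun_space (units V E)"
  by (simp add: contr_op_def fun_space_def)

lemma linear_adj_op: "Vector_Spaces.linear fscale fscale A"
  unfolding Vector_Spaces.linear_iff
  by (intro conjI cfun.vector_space_axioms)
    (auto simp: adj_op_def fscale_def fun_eq_iff sum.distrib distrib_left sum_distrib_left
      mult.left_commute)

lemma linear_contr_op: "Vector_Spaces.linear fscale fscale contr"
  unfolding Vector_Spaces.linear_iff
  by (intro conjI cfun.vector_space_axioms)
    (auto simp: contr_op_def fscale_def fun_eq_iff sum.distrib distrib_left sum_distrib_left
      mult.left_commute)

text \<open>An edge is a disjoint union of units.\<close>

lemma sum_edge_zero:
  assumes z: "z \<in> unitwise_zero_sum" and e: "e \<in> E"
  shows "sum z e = 0"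
proof -
  have "sum z (W \<inter> e) = 0" if W: "W \<in> units V E" for W
    using unit_Int_edge[OF W e] z W
    by (cases "W \<inter> e = {}") (auto simp: unitwise_zero_sum_def Int_absorb2)
  then show ?thesis using sum_by_units[OF edge_subset[OF e], of z] by simp
qed

text \<open>In the sum over an edge without \<open>v\<close> everything cancels except \<open>- z v\<close>.\<close>

lemma adj_op_unitwise_zero_sum:
  assumes z: "z \<in> unitwise_zero_sum" and v: "v \<in> V"
  shows "A z v = \<mu> (unit_of v) * z v"
proof -
  have "A z v = (\<Sum>e\<in>star E v. of_real (edge_weight v e) * (- z v))"
    unfolding adj_op_alt[OF v] using sum_edge_zero[OF z] by (intro sum.cong) (auto simp: star_def)
  then show ?thesis using v by (simp add: unit_eigenvalue_unit_of sum_distrib_right sum_negf)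
qed

lemma sum_blow_edge:
  assumes "e \<in> E"
  shows "sum (blow y) e = (\<Sum>W\<in>units V E. of_nat (card (W \<inter> e)) * y W)"
proof -
  have "sum (blow y) (W \<inter> e) = of_nat (card (W \<inter> e)) * y W" if W: "W \<in> units V E" for W
    using unit_of_eq[OF W] unit_subset[OF W] by (simp add: blow_apply subset_iff)
  then show ?thesis using sum_by_units[OF edge_subset[OF assms], of "blow y"] by simp
qed

text \<open>The contraction is designed for this: its coefficients are what remains when the sum over an
  edge is grouped by units.\<close>

lemma adj_op_blow: "A (blow y) = blow (contr y)"
proof
  fix v
  show "A (blow y) v = blow (contr y) v"
  proof (cases "v \<in> V")
    case v: True
    let ?w = "\<lambda>e. complex_of_real (edge_weight v e)"
    let ?k = "\<lambda>W e. of_nat (card (W \<inter> e)) - (if W = unit_of v then 1 else 0 :: complex)"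
    have "A (blow y) v = (\<Sum>e\<in>star E v. ?w e * (\<Sum>W\<in>units V E. ?k W e * y W))"
      unfolding adj_op_alt[OF v]
    proof (intro sum.cong refl)
      fix e assume "e \<in> star E v"
      then have e: "e \<in> E" by (simp add: star_def)
      have "(\<Sum>W\<in>units V E. ?k W e * y W) = (\<Sum>W\<in>units V E. of_nat (card (W \<inter> e)) * y W)
          - (\<Sum>W\<in>units V E. (if W = unit_of v then 1 else 0) * y W)"
        by (simp only: left_diff_distrib sum_subtractf)
      also have "\<dots> = sum (blow y) e - blow y v"
        unfolding sum_blow_edge[OF e] using v
        by (simp add: blow_apply finite_units unit_of_in_units
            if_distrib[of "\<lambda>t. t * _"] cong: if_cong)
      finally show "?w e * (sum (blow y) e - blow y v) = ?w e * (\<Sum>W\<in>units V E. ?k W e * y W)"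
        by simp
    qed
    also have "\<dots> = (\<Sum>W\<in>units V E. (\<Sum>e\<in>star E v. ?w e * ?k W e) * y W)"
      by (simp add: sum_distrib_left sum_distrib_right mult.assoc sum.swap[of _ "units V E"])
    also have "\<dots> = (\<Sum>W\<in>units V E. of_real (contr_coeff V E c \<delta>E W (unit_of v)) * y W)"
      using v by (intro sum.cong refl arg_cong2[of _ _ _ _ "(*)"])
        (simp add: contr_coeff_unit_of if_distrib[of complex_of_real])
    also have "\<dots> = blow (contr y) v"
      using v by (simp add: blow_apply contr_op_def unit_of_in_units)
    finally show ?thesis .
  qed (simp add: adj_op_def blow_apply)
qed

section \<open>Eigenspaces\<close>

lemma zero_sum_space_subset_eigenspace:
  assumes W: "W \<in> units V E"
  shows "zero_sum_space V W \<subseteq> eigenspace V A (\<mu> W)"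
proof
  fix z assume z: "z \<in> zero_sum_space V W"
  then have zs: "z \<in> unitwise_zero_sum"
    by (simp add: zero_sum_space_eq_span[OF W] span_unit_diff)
  have "A z v = \<mu> W * z v" for v
  proof (cases "v \<in> V")
    case True
    have "z v = 0 \<or> unit_of v = W"
      using z True unit_of_eq[OF W] by (auto simp: zero_sum_space_def)
    then show ?thesis using adj_op_unitwise_zero_sum[OF zs True] by auto
  qed (use z in \<open>simp add: zero_sum_space_def fun_space_def adj_op_def\<close>)
  then show "z \<in> eigenspace V A (\<mu> W)"
    using z by (simp add: eigenspace_def zero_sum_space_def fscale_def fun_eq_iff)
qed

lemma dim_zero_sum_space:
  assumes W: "W \<in> units V E"
  shows "cfun.dim (zero_sum_space V W) = card W - 1"
  using unit_diff_independent[of "nonreps \<inter> W"] W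
  by (simp add: zero_sum_space_eq_span cfun.dim_eq_card_independent card_image
      card_nonreps_Int_unit)

lemma is_eigenvalue_unit_eigenvalue:
  assumes W: "W \<in> units V E" and "card W - 1 > 0"
  shows "is_eigenvalue V A (\<mu> W)"
proof -
  have "nonreps \<inter> W \<noteq> {}"
    using assms card_nonreps_Int_unit[OF W] by (metis card.empty less_irrefl)
  then obtain v where v: "v \<in> nonreps \<inter> W" by blast
  then have "unit_diff v \<in> zero_sum_space V W"
    by (simp add: zero_sum_space_eq_span[OF W] cfun.span_base)
  then have "unit_diff v \<in> eigenspace V A (\<mu> W)"
    using zero_sum_space_subset_eigenspace[OF W] by blast
  moreover have "unit_diff v v = 1" using v by (simp add: unit_diff_nonrep delta_def)
  ultimately show ?thesis
    unfolding is_eigenvalue_def is_eigenvector_def by (intro exI[of _ "unit_diff v"]) auto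
qed

lemma is_eigenvector_blow:
  assumes "is_eigenvector (units V E) contr \<theta> y"
  shows "is_eigenvector V A \<theta> (blow y)"
proof -
  interpret b: Vector_Spaces.linear fscale fscale blow by (rule linear_blow)
  from assms have y: "y \<in> fun_space (units V E)" "contr y = fscale \<theta> y" "y \<noteq> 0"
    by (auto simp: is_eigenvector_def eigenspace_def)
  have "blow y \<noteq> 0"
    using y blow_in_unitwise_zero_sum[OF y(1)] cfun.subspace_0[OF subspace_unitwise_zero_sum] by auto
  then show ?thesis
    using y by (simp add: is_eigenvector_def eigenspace_def blow_in_fun_space adj_op_blow b.scale)
qed

text \<open>Split an eigenvector into its unitwise mean and a unitwise zero-sum function. The operator
  preserves both summands, so both components satisfy the eigenvalue equation; on the zero-sum part
  that equation says that the function vanishes on all units with another eigenvalue.\<close>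

lemma eigenspace_decomposition:
  "eigenspace V A \<theta> = {z + b | z b. z \<in> cfun.span (unit_diff ` {v \<in> nonreps. \<mu> (unit_of v) = \<theta>}) \<and>
     b \<in> blow ` eigenspace (units V E) contr \<theta>}" (is "_ = ?R")
proof -
  interpret b: Vector_Spaces.linear fscale fscale blow by (rule linear_blow)
  interpret A: Vector_Spaces.linear fscale fscale A by (rule linear_adj_op)
  have Z: "cfun.span (unit_diff ` {v \<in> nonreps. \<mu> (unit_of v) = \<theta>})
      = {z \<in> unitwise_zero_sum. A z = fscale \<theta> z}" (is "?L = ?Z")
  proof -
    have "?L = {z \<in> unitwise_zero_sum. \<forall>v\<in>nonreps. \<mu> (unit_of v) \<noteq> \<theta> \<longrightarrow> z v = 0}"
      by (subst span_unit_diff) auto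
    also have "\<dots> = ?Z"
    proof (intro Collect_cong conj_cong refl)
      fix z assume z: "z \<in> unitwise_zero_sum"
      have "(\<forall>v\<in>nonreps. \<mu> (unit_of v) \<noteq> \<theta> \<longrightarrow> z v = 0)
          \<longleftrightarrow> (\<forall>v\<in>V. \<mu> (unit_of v) \<noteq> \<theta> \<longrightarrow> z v = 0)"
      proof (intro iffI ballI impI)
        fix v assume h: "\<forall>v\<in>nonreps. \<mu> (unit_of v) \<noteq> \<theta> \<longrightarrow> z v = 0"
          and v: "v \<in> V" "\<mu> (unit_of v) \<noteq> \<theta>"
        show "z v = 0"
        proof (rule unitwise_zero_sum_vanish[OF z, of "unit_of v"])
          fix u assume u: "u \<in> nonreps \<inter> unit_of v"
          then have "unit_of u = unit_of v" using v by (simp add: unit_of_eq unit_of_in_units)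
          then show "z u = 0" using h u v by simp
        qed (use v in \<open>simp_all add: unit_of_in_units self_in_unit_of\<close>)
      qed (simp add: nonreps_def)
      also have "\<dots> \<longleftrightarrow> (\<forall>v\<in>V. A z v = \<theta> * z v)"
        using adj_op_unitwise_zero_sum[OF z] by auto
      also have "\<dots> \<longleftrightarrow> A z = fscale \<theta> z"
        using z adj_op_in_fun_space[of z]
        by (auto simp: fun_eq_iff fscale_def fun_space_def unitwise_zero_sum_def)
      finally show "(\<forall>v\<in>nonreps. \<mu> (unit_of v) \<noteq> \<theta> \<longrightarrow> z v = 0) \<longleftrightarrow> A z = fscale \<theta> z" .
    qed
    finally show ?thesis .
  qed
  show ?thesis
  proof
    show "?R \<subseteq> eigenspace V A \<theta>"
    proof clarify
      fix z y assume "z \<in> ?L" and y: "y \<in> eigenspace (units V E) contr \<theta>"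
      then have z: "z \<in> unitwise_zero_sum" "A z = fscale \<theta> z" using Z by auto
      have "A (blow y) = fscale \<theta> (blow y)"
        using y by (simp add: adj_op_blow eigenspace_def b.scale)
      moreover have "z + blow y \<in> fun_space V"
        using z blow_in_fun_space
        by (intro cfun.subspace_add subspace_fun_space) (auto simp: unitwise_zero_sum_def)
      ultimately show "z + blow y \<in> eigenspace V A \<theta>"
        using z by (simp add: eigenspace_def A.add cfun.scale_right_distrib)
    qed
    show "eigenspace V A \<theta> \<subseteq> ?R"
    proof
      fix x assume "x \<in> eigenspace V A \<theta>"
      then have x: "x \<in> fun_space V" "A x = fscale \<theta> x" by (auto simp: eigenspace_def)
      define y z where "y = unit_mean x" and "z = x - blow y"
      have z: "z \<in> unitwise_zero_sum" using x by (simp add: z_def y_def minus_mean_in_unitwise_zero_sum)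
      have y: "y \<in> fun_space (units V E)" by (simp add: y_def unit_mean_in_fun_space)
      have xz: "x = z + blow y" by (simp add: z_def)
      \<comment> \<open>The equation \<open>A x = fscale \<theta> x\<close> with the two components on different sides.\<close>
      have "blow (contr y - fscale \<theta> y) = fscale \<theta> z - A z"
        using x(2) by (simp add: xz A.add adj_op_blow b.diff b.scale cfun.scale_right_distrib algebra_simps)
      moreover have "A z \<in> unitwise_zero_sum"
      proof -
        have "sum (A z) W = 0" if W: "W \<in> units V E" for W
        proof -
          have "sum (A z) W = (\<Sum>v\<in>W. \<mu> W * z v)"
            using W unit_subset[OF W] unit_of_eq[OF W]
            by (intro sum.cong) (auto simp: adj_op_unitwise_zero_sum[OF z])
          then show ?thesis using z W by (simp add: unitwise_zero_sum_def flip: sum_distrib_left)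
        qed
        then show ?thesis by (simp add: unitwise_zero_sum_def adj_op_in_fun_space)
      qed
      ultimately have "blow (contr y - fscale \<theta> y) \<in> unitwise_zero_sum"
        using z subspace_unitwise_zero_sum by (simp add: cfun.subspace_diff cfun.subspace_scale)
      moreover have "contr y - fscale \<theta> y \<in> fun_space (units V E)"
        using y by (intro cfun.subspace_diff cfun.subspace_scale subspace_fun_space contr_op_in_fun_space)
      ultimately have 0: "contr y - fscale \<theta> y = 0" by (rule blow_in_unitwise_zero_sum[rotated])
      then have "y \<in> eigenspace (units V E) contr \<theta>" using y by (simp add: eigenspace_def)
      moreover have "A z = fscale \<theta> z"
        using \<open>blow (contr y - fscale \<theta> y) = fscale \<theta> z - A z\<close> 0 by simp
      ultimately show "x \<in> ?R" using xz z Z by blast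
    qed
  qed
qed

lemma dim_eigenspace:
  "cfun.dim (eigenspace V A \<theta>) = (\<Sum>W\<in>{W \<in> units V E. \<mu> W = \<theta>}. card W - 1)
     + cfun.dim (eigenspace (units V E) contr \<theta>)"
proof -
  interpret b: Vector_Spaces.linear fscale fscale blow by (rule linear_blow)
  interpret contr: Vector_Spaces.linear fscale fscale contr by (rule linear_contr_op)
  let ?N = "{v \<in> nonreps. \<mu> (unit_of v) = \<theta>}" and ?Y = "eigenspace (units V E) contr \<theta>"
  have N: "?N \<subseteq> nonreps" by blast
  have Y: "?Y \<subseteq> fun_space (units V E)" by (auto simp: eigenspace_def)
  have subY: "cfun.subspace ?Y"
    using subspace_fun_space[of "units V E"]
    by (auto simp: cfun.subspace_def eigenspace_def contr.add contr.scale cfun.scale_right_distrib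
        mult.commute)
  obtain B where B: "B \<subseteq> ?Y" "cfun.independent B" "?Y \<subseteq> cfun.span B" "card B = cfun.dim ?Y"
    using cfun.basis_exists by blast
  have BU: "B \<subseteq> fun_space (units V E)" using B Y by blast
  have finB: "finite B" using finite_independent_fun_space[OF finite_units BU B(2)] .
  have "cfun.span B = ?Y" using B subY by (intro cfun.span_subspace)
  then have "eigenspace V A \<theta> = cfun.span (unit_diff ` ?N \<union> blow ` B)"
    by (simp add: eigenspace_decomposition cfun.span_Un b.span_image)
  then have "cfun.dim (eigenspace V A \<theta>) = card (unit_diff ` ?N \<union> blow ` B)"
    using independent_unit_diff_blow(2)[OF N BU B(2)] by (simp add: cfun.dim_eq_card_independent)
  also have "\<dots> = card (unit_diff ` ?N) + card (blow ` B)"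
    using independent_unit_diff_blow(1)[OF N BU B(2)] finB finite_nonreps
    by (intro card_Un_disjoint) auto
  also have "card (unit_diff ` ?N) = card ?N"
    by (intro card_image unit_diff_independent N)
  also have "card (blow ` B) = card B"
    by (intro card_image inj_on_subset[OF inj_on_blow BU])
  finally show ?thesis using B(4) card_nonreps_by_unit[of "\<lambda>W. \<mu> W = \<theta>"] by simp
qed

section \<open>The spectrum with algebraic multiplicities\<close>

text \<open>The change to the adapted basis makes the matrix block diagonal: \<open>D\<close> holds the eigenvalues of
  the units, once for every non-representative, and \<open>C\<close> is the matrix of the contraction.\<close>

lemma spectrum_adj_op:
  "spectrum_mset V A = (\<Sum>W\<in>units V E. replicate_mset (card W - 1) (\<mu> W))
     + spectrum_mset (units V E) contr"
proof -
  interpret b: Vector_Spaces.linear fscale fscale blow by (rule linear_blow)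
  obtain ns where ns: "distinct ns" "set ns = nonreps"
    using finite_distinct_list[OF finite_nonreps] by blast
  \<comment> \<open>The enumeration of the units in the definition of the spectrum, so that \<open>C\<close> is literally the
    matrix used there.\<close>
  define ys where "ys = (SOME ys. distinct ys \<and> set ys = units V E)"
  have ys: "distinct ys" "set ys = units V E"
    using someI_ex[of "\<lambda>ys. distinct ys \<and> set ys = units V E"] finite_distinct_list[OF finite_units]
    unfolding ys_def by auto
  define n m where "n = length ns" and "m = length ys"
  define bs where "bs = map unit_diff ns @ map (\<lambda>W. blow (delta W)) ys"
  define D where "D = mat n n (\<lambda>(i, j). if i = j then \<mu> (unit_of (ns ! i)) else 0)"
  define C where "C = op_mat ys contr"
  define M where "M = four_block_mat D (0\<^sub>m n m) (0\<^sub>m m n) C"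
  have D: "D \<in> carrier_mat n n" and C: "C \<in> carrier_mat m m"
    by (simp_all add: D_def C_def op_mat_def m_def)
  have bs1: "bs ! j = unit_diff (ns ! j)" if "j < n" for j
    using that by (simp add: bs_def n_def nth_append)
  have bs2: "bs ! (n + j) = blow (delta (ys ! j))" if "j < m" for j
    using that by (simp add: bs_def n_def m_def nth_append)
  have deltaU: "delta ` units V E \<subseteq> fun_space (units V E)"
    by (rule image_subsetI) (rule delta_in_fun_space)
  note ind = independent_unit_diff_blow[OF subset_refl deltaU independent_delta(2)[OF finite_units]]
  have set_bs: "set bs = unit_diff ` nonreps \<union> blow ` delta ` units V E"
    by (auto simp: bs_def ns ys)
  have "inj_on (\<lambda>W. blow (delta W)) (units V E)"
    using comp_inj_on[OF independent_delta(1)[OF finite_units] inj_on_subset[OF inj_on_blow deltaU]]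
    by (simp add: o_def)
  then have dist: "distinct bs"
    using ind(1) ns ys unit_diff_independent(1)[OF subset_refl]
    by (auto simp: bs_def distinct_map)
  have "card V = card nonreps + card (units V E)"
  proof -
    have "card V = (\<Sum>W\<in>units V E. card W)"
      using sum_by_units[OF subset_refl, of "\<lambda>_. 1::nat"] unit_subset
      by (simp add: Int_absorb2 cong: sum.cong)
    also have "\<dots> = (\<Sum>W\<in>units V E. (card W - 1) + 1)"
      using card_unit_pos by (intro sum.cong refl) force
    also have "\<dots> = card nonreps + card (units V E)"
      using card_nonreps_by_unit[of "\<lambda>_. True"] by (simp add: sum.distrib del: One_nat_def)
    finally show ?thesis .
  qed
  also have "\<dots> = n + m"
    using distinct_card[OF ns(1)] distinct_card[OF ys(1)] by (simp add: n_def m_def ns ys)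
  finally have cardV: "card V = n + m" .
  have "spectrum_mset V A = proots (char_poly M)"
  proof (rule spectrum_mset_change_of_basis[OF finite_V linear_adj_op _ dist])
    show "set bs \<subseteq> fun_space V"
      using unit_diff_in_unitwise_zero_sum blow_in_fun_space
      by (auto simp: set_bs unitwise_zero_sum_def nonreps_def)
    show "length bs = card V" by (simp add: bs_def cardV n_def m_def)
    show "cfun.independent (set bs)" using ind(2) by (simp add: set_bs)
    show "M \<in> carrier_mat (card V) (card V)" using D C by (simp add: M_def cardV)
  next
    fix j assume j: "j < card V"
    have split: "(\<Sum>i<card V. fscale (M $$ (i, j)) (bs ! i))
        = (\<Sum>i<n. fscale (M $$ (i, j)) (bs ! i)) + (\<Sum>i<m. fscale (M $$ (n + i, j)) (bs ! (n + i)))"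
      unfolding cardV lessThan_atLeast0
      using sum.atLeastLessThan_concat[of 0 n "n + m" "\<lambda>i. fscale (M $$ (i, j)) (bs ! i)"]
        sum.shift_bounds_nat_ivl[of "\<lambda>i. fscale (M $$ (i, j)) (bs ! i)" 0 n m]
      by (simp add: add.commute)
    show "A (bs ! j) = (\<Sum>i<card V. fscale (M $$ (i, j)) (bs ! i))"
    proof (cases "j < n")
      case True
      let ?v = "ns ! j"
      have nr: "?v \<in> nonreps" using nth_mem[of j ns] True by (simp add: ns n_def)
      then have v: "?v \<in> V" by (simp add: nonreps_def)
      have "unit_diff ?v \<in> zero_sum_space V (unit_of ?v)"
        using v nr by (simp add: unit_of_in_units self_in_unit_of zero_sum_space_eq_span cfun.span_base)
      then have "A (bs ! j) = fscale (\<mu> (unit_of ?v)) (bs ! j)"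
        using subsetD[OF zero_sum_space_subset_eigenspace[OF unit_of_in_units[OF v]]] True
        by (simp add: eigenspace_def bs1)
      also have "\<dots> = (\<Sum>i<n. if i = j then fscale (\<mu> (unit_of ?v)) (bs ! j) else 0)"
        using True by simp
      also have "\<dots> = (\<Sum>i<n. fscale (M $$ (i, j)) (bs ! i))"
        using True D C by (intro sum.cong) (auto simp: M_def D_def)
      also have "\<dots> = (\<Sum>i<card V. fscale (M $$ (i, j)) (bs ! i))"
        unfolding split using True D C by (simp add: M_def)
      finally show ?thesis .
    next
      case False
      define k where "k = j - n"
      have k: "k < m" "j = n + k" using False j by (auto simp: k_def cardV)
      have bij: "bij_betw (\<lambda>i. ys ! i) {..<m} (units V E)"
        using bij_betw_nth[OF ys(1)] ys(2) m_def by simp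
      have "A (bs ! j) = blow (contr (delta (ys ! k)))"
        using k by (simp add: bs2 adj_op_blow)
      also have "contr (delta (ys ! k)) = (\<Sum>W\<in>units V E. fscale (contr (delta (ys ! k)) W) (delta W))"
        by (rule fun_space_expansion[OF finite_units contr_op_in_fun_space])
      also have "\<dots> = (\<Sum>i<m. fscale (contr (delta (ys ! k)) (ys ! i)) (delta (ys ! i)))"
        using sum.reindex_bij_betw[OF bij, symmetric] .
      also have "blow \<dots> = (\<Sum>i<m. fscale (C $$ (i, k)) (bs ! (n + i)))"
        using k by (simp add: b.sum b.scale bs2 C_def op_mat_def m_def delta_def)
      also have "\<dots> = (\<Sum>i<card V. fscale (M $$ (i, j)) (bs ! i))"
        unfolding split using k D C by (simp add: M_def)
      finally show ?thesis .
    qed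
  qed
  also have "char_poly M = char_poly D * char_poly C"
    unfolding M_def by (rule char_poly_four_block_diag[OF D C])
  also have "proots \<dots> = proots (char_poly D) + proots (char_poly C)"
    using degree_monic_char_poly[OF D] degree_monic_char_poly[OF C] by (intro proots_mult) auto
  also have "proots (char_poly C) = spectrum_mset (units V E) contr"
    by (simp add: spectrum_mset_def C_def ys_def)
  also have "proots (char_poly D) = mset (map (\<lambda>i. \<mu> (unit_of (ns ! i))) [0..<n])"
    unfolding D_def by (rule proots_char_poly_diag)
  also have "map (\<lambda>i. \<mu> (unit_of (ns ! i))) [0..<n] = map (\<lambda>v. \<mu> (unit_of v)) ns"
    by (rule nth_equalityI) (auto simp: n_def)
  also have "mset \<dots> = image_mset (\<lambda>v. \<mu> (unit_of v)) (mset_set nonreps)"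
    using ns by (simp add: mset_set_set[symmetric])
  also have "\<dots> = (\<Sum>W\<in>units V E. replicate_mset (card W - 1) (\<mu> W))"
  proof (rule multiset_eqI)
    fix \<theta>
    have "count (image_mset (\<lambda>v. \<mu> (unit_of v)) (mset_set nonreps)) \<theta>
        = card {v \<in> nonreps. \<mu> (unit_of v) = \<theta>}"
      by (simp add: count_image_mset' finite_nonreps eq_commute)
    also have "\<dots> = (\<Sum>W\<in>{W \<in> units V E. \<mu> W = \<theta>}. card W - 1)"
      by (rule card_nonreps_by_unit)
    also have "\<dots> = count (\<Sum>W\<in>units V E. replicate_mset (card W - 1) (\<mu> W)) \<theta>"
      using finite_units by (auto simp: count_sum sum.If_cases Int_def intro!: sum.mono_neutral_cong_left)
    finally show "count (image_mset (\<lambda>v. \<mu> (unit_of v)) (mset_set nonreps)) \<theta>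
        = count (\<Sum>W\<in>units V E. replicate_mset (card W - 1) (\<mu> W)) \<theta>" .
  qed
  finally show ?thesis .
qed

end

section \<open>The complete spectrum\<close>

theorem theorem3p8:
  fixes V :: "'a set" and E :: "'a set set"
    and \<delta>V :: "'a \<Rightarrow> real" and \<delta>E :: "'a set \<Rightarrow> real" and c :: "'a set set \<Rightarrow> real"
  assumes "hypergraph V E"
    and "\<forall>v\<in>V. \<delta>V v > 0"
    and "\<forall>e\<in>E. \<delta>E e > 0"
    and "\<forall>W\<in>units V E. \<forall>v\<in>W. \<delta>V v = c (generating_set V E W)"
  shows
    "spectrum_mset V (adj_op V E \<delta>V \<delta>E) =
       (\<Sum>W\<in>units V E. replicate_mset (card W - 1) (unit_eigenvalue V E c \<delta>E W))
       + spectrum_mset (units V E) (contr_op V E c \<delta>E) \<and>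
     (\<forall>\<theta>. cfun.dim (eigenspace V (adj_op V E \<delta>V \<delta>E) \<theta>) =
       (\<Sum>W\<in>{W \<in> units V E. unit_eigenvalue V E c \<delta>E W = \<theta>}. card W - 1)
       + cfun.dim (eigenspace (units V E) (contr_op V E c \<delta>E) \<theta>)) \<and>
     (\<forall>W\<in>units V E.
       (card W - 1 > 0 \<longrightarrow>
         is_eigenvalue V (adj_op V E \<delta>V \<delta>E) (unit_eigenvalue V E c \<delta>E W)) \<and>
       cfun.subspace (zero_sum_space V W) \<and>
       zero_sum_space V W \<subseteq> eigenspace V (adj_op V E \<delta>V \<delta>E) (unit_eigenvalue V E c \<delta>E W) \<and>
       cfun.dim (zero_sum_space V W) = card W - 1) \<and>
     (\<forall>\<theta> y. is_eigenvector (units V E) (contr_op V E c \<delta>E) \<theta> y \<longrightarrow>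
       is_eigenvector V (adj_op V E \<delta>V \<delta>E) \<theta> (blow_up V E y))"
proof -
  interpret unit_weighted_hypergraph V E \<delta>V \<delta>E c
    using assms(1,4) by unfold_locales
  show ?thesis
  proof (intro conjI allI ballI impI)
    fix W assume W: "W \<in> units V E"
    show "cfun.subspace (zero_sum_space V W)"
      unfolding zero_sum_space_eq_span[OF W] by (rule cfun.subspace_span)
  qed (fact spectrum_adj_op dim_eigenspace | rule is_eigenvalue_unit_eigenvalue
      zero_sum_space_subset_eigenspace dim_zero_sum_space is_eigenvector_blow, assumption+)+
qed

end
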